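(* Let $\beta \in \mathbb{R}$ and $\gamma > 0$. Let $X$ (runs scored per game) and $Y$ (runs allowed per game) be two independent real random variables drawn from Weibull distributions with parameters $(\alpha_{\mathrm{RS}}, \beta, \gamma)$ and $(\alpha_{\mathrm{RA}}, \beta, \gamma)$ respectively, where $\alpha_{\mathrm{RS}} > 0$ and $\alpha_{\mathrm{RA}} > 0$ are chosen so that the means are $\mathbb{E}[X] = \mathrm{RS}$ and $\mathbb{E}[Y] = \mathrm{RA}$. Then the won-loss percentage, i.e. the probability that $X$ exceeds $Y$, is $$\mathrm{Prob}(X > Y) \;=\; \frac{(\mathrm{RS}-\beta)^{\gamma}}{(\mathrm{RS}-\beta)^{\gamma} + (\mathrm{RA}-\beta)^{\gamma}}.$$
   Context: For $\alpha > 0$, $\beta \in \mathbb{R}$ and $\gamma > 0$, the (three-parameter) Weibull distribution with parameters $(\alpha,\beta,\gamma)$ is the probability distribution on $\mathbb{R}$ with density $$f(x;\alpha,\beta,\gamma) = \begin{cases} \dfrac{\gamma}{\alpha}\left(\dfrac{x-\beta}{\alpha}\right)^{\gamma-1} e^{-((x-\beta)/\alpha)^{\gamma}} & \text{if } x \ge \beta,\\[2mm] 0 & \text{otherwise.}\end{cases}$$ The won-loss percentage predicted by the model is by definition the probability $\mathrm{Prob}(X>Y)$ that the number of runs scored $X$ exceeds the number of runs allowed $Y$. $\mathrm{RS}$ and $\mathrm{RA}$ denote the means of $X$ and $Y$. *)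

theory Defs
  imports "HOL-Probability.Probability"
begin

(* At the single point x = b the power is 0 powr (g - 1) = 0, also for g \<le> 1, where the
   formula would read 0^0 or be undefined. The point is a Lebesgue null set, so the
   distribution with this density is unaffected. *)
definition weibull_density :: "real \<Rightarrow> real \<Rightarrow> real \<Rightarrow> real \<Rightarrow> real" where
  "weibull_density a b g x =
     (if b \<le> x
      then g / a * ((x - b) / a) powr (g - 1) * exp (- (((x - b) / a) powr g))
      else 0)"

(* The coercion to ennreal in "distributed" therefore does not truncate the density. *)
lemma weibull_density_nonneg:
  assumes "a > 0" "g > 0"
  shows "0 \<le> weibull_density a b g x"
  using assms by (simp add: weibull_density_def)

end

theory Submission
  imports Defs
begin

text \<open>If \<open>X\<close> is Weibull with parameters \<open>(\<alpha>, \<beta>, \<gamma>)\<close>, then \<open>U = ((X - \<beta>) / \<alpha>)\<^sup>\<gamma>\<close> is a standard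
  exponential variable, and \<open>X = \<beta> + \<alpha> U\<^bsup>1/\<gamma>\<^esup>\<close>. Hence the mean of \<open>X\<close> is \<open>\<beta> + \<alpha> \<Gamma>(1 + 1/\<gamma>)\<close>, and
  \<open>X > Y\<close> compares the independent exponential variables \<open>\<alpha>RS\<^sup>\<gamma> U\<close> and \<open>\<alpha>RA\<^sup>\<gamma> V\<close>. The
  probability depends only on the ratio of the scale parameters, which is the ratio of the
  shifted means.\<close>

lemma weibull_density_eq_0:
  assumes "x \<le> b"
  shows "weibull_density a b g x = 0"
  using assms by (auto simp: weibull_density_def)

lemma borel_measurable_weibull_density [measurable]:
  "weibull_density a b g \<in> borel_measurable borel"
  unfolding weibull_density_def[abs_def] by measurable

text \<open>The negative survival function \<open>?F\<close> is an antiderivative of the density on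
  \<open>{t..}\<close> and tends to 0 at infinity. The strict bound \<open>b < t\<close> avoids the
  endpoint \<open>b\<close>, where \<open>?F\<close> is not differentiable for
  \<open>g < 1\<close>.\<close>

lemma nn_integral_weibull_density_atLeast:
  assumes "a > 0" "g > 0" "b < t"
  shows "(\<integral>\<^sup>+x. ennreal (weibull_density a b g x) * indicator {t..} x \<partial>lborel)
    = exp (- (((t - b) / a) powr g))"
proof -
  let ?F = "\<lambda>x. - exp (- (((x - b) / a) powr g))"
  have "(\<integral>\<^sup>+x. ennreal (weibull_density a b g x) * indicator {t..} x \<partial>lborel) = 0 - ?F t"
  proof (rule nn_integral_FTC_atLeast)
    show "DERIV ?F x :> weibull_density a b g x" if "t \<le> x" for x
      using assms that
      by (auto intro!: derivative_eq_intros simp: weibull_density_def powr_diff field_simps)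
    have "LIM x at_top. ((x - b) / a) powr g :> at_top"
      using assms by real_asymp
    then have "((\<lambda>x. exp (- (((x - b) / a) powr g))) \<longlongrightarrow> 0) at_top"
      by (intro filterlim_compose[OF exp_at_bot] filterlim_compose[OF filterlim_uminus_at_bot_at_top])
    then show "(?F \<longlongrightarrow> 0) at_top"
      using tendsto_minus by fastforce
  qed (use assms weibull_density_nonneg in auto)
  then show ?thesis by simp
qed

context prob_space
begin

text \<open>The truncation by \<open>max 0\<close> keeps \<open>powr\<close> away from negative bases; it is inactive almost surely.\<close>

lemma weibull_distributed_imp_exponential:
  assumes X: "distributed M lborel X (weibull_density a b g)" and ag: "a > 0" "g > 0"
  shows "distributed M lborel (\<lambda>\<omega>. max 0 ((X \<omega> - b) / a) powr g) (exponential_density 1)"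
proof (subst exponential_distributed_iff, simp, intro conjI allI impI)
  have [measurable]: "X \<in> borel_measurable M"
    using distributed_measurable[OF X] by simp
  show "(\<lambda>\<omega>. max 0 ((X \<omega> - b) / a) powr g) \<in> borel_measurable M"
    by measurable
  fix u :: real
  assume u: "0 \<le> u"
  \<comment> \<open>The inverse image of \<open>u\<close> under the transformation, so that the
    event that the transformed variable is at most \<open>u\<close> becomes
    \<open>X \<omega> \<le> t\<close>.\<close>
  define t where "t = b + a * u powr (1 / g)"
  have tu: "((t - b) / a) powr g = u"
    using ag u by (simp add: t_def powr_powr)
  have iff: "max 0 ((x - b) / a) powr g \<le> u \<longleftrightarrow> x \<le> t" for x
  proof -
    have "max 0 ((x - b) / a) powr g \<le> u \<longleftrightarrow> max 0 ((x - b) / a) \<le> u powr (1 / g)"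
    proof
      assume "max 0 ((x - b) / a) powr g \<le> u"
      then have "(max 0 ((x - b) / a) powr g) powr (1 / g) \<le> u powr (1 / g)"
        using ag by (intro powr_mono2) auto
      then show "max 0 ((x - b) / a) \<le> u powr (1 / g)"
        using ag by (simp add: powr_powr)
    next
      assume "max 0 ((x - b) / a) \<le> u powr (1 / g)"
      then have "max 0 ((x - b) / a) powr g \<le> (u powr (1 / g)) powr g"
        using ag by (intro powr_mono2) auto
      then show "max 0 ((x - b) / a) powr g \<le> u"
        using ag u by (simp add: powr_powr)
    qed
    \<comment> \<open>The bound \<open>u powr (1 / g)\<close> is nonnegative, so the truncation
      drops out.\<close>
    also have "\<dots> \<longleftrightarrow> x \<le> t"
      using ag by (simp add: t_def field_simps)
    finally show ?thesis .
  qed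
  have "prob {\<omega> \<in> space M. X \<omega> \<le> t} = 1 - exp (- u)"
  \<comment> \<open>For \<open>u = 0\<close> the threshold is \<open>b\<close> itself, which the
    tail formula excludes; there the density vanishes on all of \<open>{..t}\<close>.\<close>
  proof (cases "u = 0")
    case True
    then have t: "t = b"
      by (simp add: t_def)
    have "emeasure M (X -` {..t} \<inter> space M)
      = (\<integral>\<^sup>+x. ennreal (weibull_density a b g x) * indicator {..t} x \<partial>lborel)"
      by (intro distributed_emeasure[OF X]) simp
    also have "\<dots> = (\<integral>\<^sup>+(x::real). 0 \<partial>lborel)"
      by (intro nn_integral_cong) (simp add: t weibull_density_eq_0 split: split_indicator)
    finally have "prob (X -` {..t} \<inter> space M) = 0"
      by (simp add: measure_def)
    moreover have "X -` {..t} \<inter> space M = {\<omega> \<in> space M. X \<omega> \<le> t}"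
      by auto
    ultimately show ?thesis
      using True by simp
  next
    case False
    then have t: "b < t"
      using ag u by (simp add: t_def)
    have "emeasure M (X -` {t<..} \<inter> space M)
      = (\<integral>\<^sup>+x. ennreal (weibull_density a b g x) * indicator {t<..} x \<partial>lborel)"
      by (intro distributed_emeasure[OF X]) simp
    \<comment> \<open>The open and the closed half-line differ by a null set.\<close>
    also have "\<dots> = (\<integral>\<^sup>+x. ennreal (weibull_density a b g x) * indicator {t..} x \<partial>lborel)"
      by (intro nn_integral_cong_AE eventually_mono[OF AE_lborel_singleton[of t]])
        (auto split: split_indicator)
    also have "\<dots> = exp (- u)"
      using nn_integral_weibull_density_atLeast[OF ag t] tu by simp
    finally have "prob (X -` {t<..} \<inter> space M) = exp (- u)"
      by (simp add: measure_def)
    moreover have "{\<omega> \<in> space M. X \<omega> \<le> t} = space M - (X -` {t<..} \<inter> space M)"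
      by auto
    ultimately show ?thesis
      by (simp add: prob_compl)
  qed
  then show "\<P>(\<omega> in M. max 0 ((X \<omega> - b) / a) powr g \<le> u) = 1 - exp (- u * 1)"
    by (simp add: iff)
qed

lemma AE_weibull_distributed_ge:
  assumes X: "distributed M lborel X (weibull_density a b g)"
  shows "AE \<omega> in M. b \<le> X \<omega>"
  by (subst distributed_AE2[OF X]) (auto simp: weibull_density_def)

text \<open>The moment is Euler's integral for Gamma at \<open>1 + p\<close>, which converges
  because \<open>p > -1\<close>. As the integrand is nonnegative, one computation with values in
  \<open>ennreal\<close> yields both integrability and the value.\<close>

lemma exponential_distributed_expectation_powr:
  assumes U: "distributed M lborel U (exponential_density 1)" and p: "p > -1"
  shows "has_bochner_integral M (\<lambda>\<omega>. U \<omega> powr p) (Gamma (1 + p))"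
proof (rule has_bochner_integral_nn_integral)
  show "(\<lambda>\<omega>. U \<omega> powr p) \<in> borel_measurable M"
    using distributed_measurable[OF U] by simp
  have "(\<integral>\<^sup>+\<omega>. ennreal (U \<omega> powr p) \<partial>M)
    = (\<integral>\<^sup>+u. ennreal (exponential_density 1 u) * ennreal (u powr p) \<partial>lborel)"
    by (intro distributed_nn_integral[OF U, symmetric]) simp
  also have "\<dots> = (\<integral>\<^sup>+t. ennreal (indicator {0..} t * t powr (1 + p - 1) / exp t) \<partial>lborel)"
    by (intro nn_integral_cong)
      (auto simp: exponential_density_def ennreal_mult[symmetric] exp_minus field_simps
        split: split_indicator)
  also have "\<dots> = Gamma (1 + p)"
    using p by (intro Gamma_conv_nn_integral_real[symmetric]) simp
  finally show "(\<integral>\<^sup>+\<omega>. ennreal (U \<omega> powr p) \<partial>M) = Gamma (1 + p)" .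
  show "0 \<le> Gamma (1 + p)"
    using Gamma_real_pos[of "1 + p"] p by simp
qed simp

lemma weibull_distributed_expectation:
  assumes X: "distributed M lborel X (weibull_density a b g)" and ag: "a > 0" "g > 0"
  shows "expectation X = b + a * Gamma (1 + 1 / g)"
proof -
  let ?U = "\<lambda>\<omega>. max 0 ((X \<omega> - b) / a) powr g"
  have [measurable]: "X \<in> borel_measurable M"
    using distributed_measurable[OF X] by simp
  have "has_bochner_integral M (\<lambda>\<omega>. ?U \<omega> powr (1 / g)) (Gamma (1 + 1 / g))"
    using ag by (intro exponential_distributed_expectation_powr
        weibull_distributed_imp_exponential[OF X ag]) (simp add: less_trans[of "-1" 0])
  then have U: "integrable M (\<lambda>\<omega>. ?U \<omega> powr (1 / g))"
    "expectation (\<lambda>\<omega>. ?U \<omega> powr (1 / g)) = Gamma (1 + 1 / g)"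
    by (auto simp: has_bochner_integral_iff)
  \<comment> \<open>Where \<open>b \<le> X \<omega>\<close> the truncation is inactive and the
    exponents \<open>g\<close> and \<open>1 / g\<close> cancel.\<close>
  have "AE \<omega> in M. X \<omega> = b + a * ?U \<omega> powr (1 / g)"
    using AE_weibull_distributed_ge[OF X] by eventually_elim (use ag in \<open>simp add: powr_powr\<close>)
  then have "expectation X = expectation (\<lambda>\<omega>. b + a * ?U \<omega> powr (1 / g))"
    by (intro integral_cong_AE) auto
  also have "\<dots> = b + a * Gamma (1 + 1 / g)"
    by (subst Bochner_Integration.integral_add) (use U in \<open>auto simp: prob_space\<close>)
  finally show ?thesis .
qed

text \<open>Given \<open>W = w\<close>, the event has probability \<open>exp (- w * k)\<close>;
  averaging this tail over the density of \<open>W\<close> gives the ratio of the rates.\<close>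

lemma exponential_distributed_prob_gt:
  assumes V: "distributed M lborel V (exponential_density k)"
    and W: "distributed M lborel W (exponential_density l)"
    and indep: "indep_var borel V borel W" and kl: "k > 0" "l > 0"
  shows "\<P>(\<omega> in M. V \<omega> > W \<omega>) = l / (k + l)"
proof -
  \<comment> \<open>Composition with \<open>id\<close> moves independence from \<open>borel\<close>
    to \<open>lborel\<close>, the measure used by the densities.\<close>
  have "indep_var lborel (id \<circ> V) lborel (id \<circ> W)"
    using indep by (rule indep_var_compose) auto
  then have J: "distributed M (lborel \<Otimes>\<^sub>M lborel) (\<lambda>\<omega>. (V \<omega>, W \<omega>))
      (\<lambda>(v, w). ennreal (exponential_density k v) * ennreal (exponential_density l w))"
    by (intro distributed_joint_indep V W lborel.sigma_finite_measure_axioms) simp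
  have tail: "(\<integral>\<^sup>+v. ennreal (exponential_density k v) * indicator {w<..} v \<partial>lborel)
      = exp (- w * k)" if "w \<ge> 0" for w
  proof -
    have "(\<integral>\<^sup>+v. ennreal (exponential_density k v) * indicator {w<..} v \<partial>lborel)
        = emeasure M (V -` {w<..} \<inter> space M)"
      by (intro distributed_emeasure[OF V, symmetric]) simp
    also have "V -` {w<..} \<inter> space M = {\<omega> \<in> space M. w < V \<omega>}"
      by auto
    finally show ?thesis
      by (simp add: emeasure_eq_measure exponential_distributedD_gt[OF V that kl(1)])
  qed
  let ?A = "{p. fst p > snd p} :: (real \<times> real) set"
  have A [measurable]: "?A \<in> sets (lborel \<Otimes>\<^sub>M lborel)"
  proof -
    have "{p \<in> space (borel \<Otimes>\<^sub>M borel). fst p > snd p} \<in> sets (borel \<Otimes>\<^sub>M (borel :: real measure))"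
      by measurable
    then show ?thesis
      by (simp add: space_pair_measure cong: sets_pair_measure_cong)
  qed
  have "emeasure M {\<omega> \<in> space M. V \<omega> > W \<omega>}
      = emeasure M ((\<lambda>\<omega>. (V \<omega>, W \<omega>)) -` ?A \<inter> space M)"
    by (intro arg_cong2[where f = emeasure]) auto
  also have "\<dots> = (\<integral>\<^sup>+p. (case p of (v, w) \<Rightarrow> ennreal (exponential_density k v)
      * ennreal (exponential_density l w)) * indicator ?A p \<partial>(lborel \<Otimes>\<^sub>M lborel))"
    by (rule distributed_emeasure[OF J A])
  \<comment> \<open>Tonelli, with \<open>v\<close> integrated first so that the inner integral is a
    tail of \<open>V\<close>.\<close>
  also have "\<dots> = (\<integral>\<^sup>+w. \<integral>\<^sup>+v. ennreal (exponential_density k v)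
      * ennreal (exponential_density l w) * indicator ?A (v, w) \<partial>lborel \<partial>lborel)"
    by (subst lborel_pair.nn_integral_snd[symmetric]) auto
  also have "\<dots> = (\<integral>\<^sup>+w. ennreal (exponential_density l w) *
      (\<integral>\<^sup>+v. ennreal (exponential_density k v) * indicator {w<..} v \<partial>lborel) \<partial>lborel)"
    by (subst nn_integral_cmult[symmetric])
      (auto intro!: nn_integral_cong simp: ac_simps split: split_indicator)
  \<comment> \<open>Density times tail is a multiple of the exponential density of rate
    \<open>k + l\<close>, whose total mass is 1. For \<open>w < 0\<close> both sides vanish, so the
    tail formula is needed only for \<open>w \<ge> 0\<close>.\<close>
  also have "\<dots> = (\<integral>\<^sup>+w. ennreal (l / (k + l)) * ennreal (exponential_density (k + l) w) \<partial>lborel)"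
  proof (intro nn_integral_cong)
    fix w :: real
    show "ennreal (exponential_density l w)
        * (\<integral>\<^sup>+v. ennreal (exponential_density k v) * indicator {w<..} v \<partial>lborel)
      = ennreal (l / (k + l)) * ennreal (exponential_density (k + l) w)"
    proof (cases "w < 0")
      case True
      then show ?thesis
        by (simp add: exponential_density_def)
    next
      case False
      have "exp (- w * (k + l)) = exp (- w * l) * exp (- w * k)"
        by (simp add: algebra_simps flip: exp_add)
      with False have "exponential_density l w * exp (- w * k)
          = l / (k + l) * exponential_density (k + l) w"
        using kl by (simp add: exponential_density_def)
      with False kl show ?thesis
        by (simp only: tail not_less ennreal_mult'[symmetric] exponential_density_nonneg
            less_imp_le divide_nonneg_pos add_pos_pos)
    qed
  qed
  also have "\<dots> = ennreal (l / (k + l)) * emeasure (density lborel (exponential_density (k + l))) UNIV"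
    by (simp add: nn_integral_cmult emeasure_density)
  also have "\<dots> = ennreal (l / (k + l))"
    using prob_space.emeasure_space_1[OF prob_space_exponential_density[of "k + l"]] kl by simp
  finally show ?thesis
    using kl by (simp add: emeasure_eq_measure)
qed

lemma weibull_distributed_prob_gt:
  assumes X: "distributed M lborel X (weibull_density a b g)"
    and Y: "distributed M lborel Y (weibull_density a' b g)"
    and indep: "indep_var borel X borel Y" and pos: "a > 0" "a' > 0" "g > 0"
  shows "\<P>(\<omega> in M. X \<omega> > Y \<omega>) = a powr g / (a powr g + a' powr g)"
proof -
  let ?V = "\<lambda>\<omega>. a powr g * max 0 ((X \<omega> - b) / a) powr g"
  let ?W = "\<lambda>\<omega>. a' powr g * max 0 ((Y \<omega> - b) / a') powr g"
  have [measurable]: "X \<in> borel_measurable M" "Y \<in> borel_measurable M"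
    using distributed_measurable[OF X] distributed_measurable[OF Y] by simp_all
  \<comment> \<open>Scaling a unit-rate exponential variable by a positive constant divides its rate
    by that constant.\<close>
  have V: "distributed M lborel ?V (exponential_density (1 / a powr g))"
    and W: "distributed M lborel ?W (exponential_density (1 / a' powr g))"
    using pos by (intro erlang_distributed_mult_const weibull_distributed_imp_exponential X Y; simp)+
  have "indep_var borel ((\<lambda>x. a powr g * max 0 ((x - b) / a) powr g) \<circ> X)
      borel ((\<lambda>y. a' powr g * max 0 ((y - b) / a') powr g) \<circ> Y)"
    using indep by (rule indep_var_compose) auto
  then have "indep_var borel ?V borel ?W"
    by (simp add: o_def)
  then have "\<P>(\<omega> in M. ?V \<omega> > ?W \<omega>) = (1 / a' powr g) / (1 / a powr g + 1 / a' powr g)"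
    using pos by (intro exponential_distributed_prob_gt V W) auto
  also have "\<dots> = a powr g / (a powr g + a' powr g)"
    using pos by (simp add: field_simps)
  \<comment> \<open>Almost surely the scalings cancel, leaving one map,
    \<open>(x - b) powr g\<close>, applied to both variables. It is strictly increasing for
    \<open>x \<ge> b\<close> and so preserves the comparison.\<close>
  also have "\<P>(\<omega> in M. ?V \<omega> > ?W \<omega>) = \<P>(\<omega> in M. X \<omega> > Y \<omega>)"
  proof (rule prob_eq_AE)
    show "AE \<omega> in M. ?V \<omega> > ?W \<omega> \<longleftrightarrow> X \<omega> > Y \<omega>"
      using AE_weibull_distributed_ge[OF X] AE_weibull_distributed_ge[OF Y]
    proof eventually_elim
      case (elim \<omega>)
      then have "?V \<omega> = (X \<omega> - b) powr g" "?W \<omega> = (Y \<omega> - b) powr g"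
        using pos by (simp_all add: powr_mult[symmetric] max_def)
      moreover have "(Y \<omega> - b) powr g < (X \<omega> - b) powr g \<longleftrightarrow> Y \<omega> - b < X \<omega> - b"
        using elim pos powr_less_mono2[of g "Y \<omega> - b" "X \<omega> - b"]
          powr_mono2[of g "X \<omega> - b" "Y \<omega> - b"] by linarith
      ultimately show ?case
        by simp
    qed
  qed measurable
  finally show ?thesis .
qed

end

theorem theorem2p2:
  fixes M :: "'a measure" and X Y :: "'a \<Rightarrow> real"
    and \<alpha>RS \<alpha>RA \<beta> \<gamma> RS RA :: real
  assumes "prob_space M"
    and "\<gamma> > 0" and "\<alpha>RS > 0" and "\<alpha>RA > 0"
    and "distributed M lborel X (weibull_density \<alpha>RS \<beta> \<gamma>)"
    and "distributed M lborel Y (weibull_density \<alpha>RA \<beta> \<gamma>)"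
    and "prob_space.indep_var M borel X borel Y"
    and "prob_space.expectation M X = RS"
    and "prob_space.expectation M Y = RA"
  shows "prob_space.prob M {\<omega> \<in> space M. X \<omega> > Y \<omega>}
    = (RS - \<beta>) powr \<gamma> / ((RS - \<beta>) powr \<gamma> + (RA - \<beta>) powr \<gamma>)"
proof -
  interpret prob_space M by fact
  \<comment> \<open>The factor between scale and shifted mean; it depends on the shape alone, so it
    is common to both variables and cancels in the quotient.\<close>
  define c where "c = Gamma (1 + 1 / \<gamma>)"
  have c: "c > 0"
    using assms(2) by (auto simp: c_def intro!: Gamma_real_pos add_pos_pos)
  have RS: "RS - \<beta> = \<alpha>RS * c" and RA: "RA - \<beta> = \<alpha>RA * c"
    using weibull_distributed_expectation assms by (auto simp: c_def)
  have "(RS - \<beta>) powr \<gamma> / ((RS - \<beta>) powr \<gamma> + (RA - \<beta>) powr \<gamma>)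
      = (\<alpha>RS powr \<gamma> * c powr \<gamma>) / ((\<alpha>RS powr \<gamma> + \<alpha>RA powr \<gamma>) * c powr \<gamma>)"
    unfolding RS RA using assms c by (simp add: powr_mult distrib_right)
  also have "\<dots> = \<alpha>RS powr \<gamma> / (\<alpha>RS powr \<gamma> + \<alpha>RA powr \<gamma>)"
    using c by simp
  finally show ?thesis
    using weibull_distributed_prob_gt assms by simp
qed

end
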